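(* Let $(M_1,g_1,J_1)$ be a metallic Riemannian manifold, let $(M,\phi,\xi,\eta,g)$ be an almost contact metric manifold, and let $F:M_1\to M$ be a smooth map such that $F_*J_1=\phi F_*$. Then $F$ is a constant map.
   Context: All manifolds and maps are $C^\infty$; $F_*$ is the differential of $F$. A metallic Riemannian manifold $(\tilde M,\tilde g,J)$ is a Riemannian manifold $(\tilde M,\tilde g)$ with a $(1,1)$-tensor field $J$ such that $J^2=pJ+qI$ for some positive integers $p,q$ ($I$ the identity) and $\tilde g(JX,Y)=\tilde g(X,JY)$ for all vector fields $X,Y$; it is assumed throughout that $\nabla J=0$ for the Levi-Civita connection $\nabla$ of $\tilde g$. An almost contact metric manifold $(M,\phi,\xi,\eta,g)$ is a $(2n+1)$-dimensional manifold $M$ with a $(1,1)$-tensor field $\phi$, a vector field $\xi$, a $1$-form $\eta$ and a Riemannian metric $g$ such that $\phi^2=-I+\eta\otimes\xi$, $\phi\xi=0$, $\eta\circ\phi=0$, $\eta(\xi)=1$, $g(\phi X,\phi Y)=g(X,Y)-\eta(X)\eta(Y)$ and $\eta(X)=g(X,\xi)$ for all vector fields $X,Y$.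
   Formalization: M_1 is assumed connected (otherwise F may take different constant values on different components, so the claim fails) and of dimension at least 1 (a connected 0-dimensional M_1 is a single point, where the claim is trivial). *)

theory Defs
  imports "HOL-Analysis.Analysis"
begin

text \<open>
  The following notions are meant for open sets S only. In finite dimension, continuity
  of all directional derivatives is continuity of the derivative.
\<close>

primrec Ck_on :: "nat \<Rightarrow> 'a::euclidean_space set \<Rightarrow> ('a \<Rightarrow> 'b::real_normed_vector) \<Rightarrow> bool" where
  "Ck_on 0 S = (\<lambda>f. continuous_on S f)"
| "Ck_on (Suc k) S = (\<lambda>f. (\<forall>x\<in>S. f differentiable (at x)) \<and>
     (\<forall>v. Ck_on k S (\<lambda>x. frechet_derivative f (at x) v)))"

definition smooth_on :: "'a::euclidean_space set \<Rightarrow> ('a \<Rightarrow> 'b::real_normed_vector) \<Rightarrow> bool" where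
  "smooth_on S f \<longleftrightarrow> (\<forall>k. Ck_on k S f)"

text \<open>
  A chart is a pair of its domain and its coordinate map; the values of the coordinate map
  outside the domain are irrelevant. The manifold is modelled on the Euclidean space
  \<open>'e\<close>, so its dimension is \<open>DIM('e)\<close>. The atlas need not be maximal.
\<close>

type_synonym ('a, 'e) chart = "'a set \<times> ('a \<Rightarrow> 'e)"

record ('a, 'e) manifold =
  mtop :: "'a topology"
  atlas :: "('a, 'e) chart set"

abbreviation points :: "('a, 'e, 'z) manifold_scheme \<Rightarrow> 'a set" where
  "points M \<equiv> topspace (mtop M)"

abbreviation dom_of :: "('a, 'e) chart \<Rightarrow> 'a set" where
  "dom_of c \<equiv> fst c"

abbreviation coord :: "('a, 'e) chart \<Rightarrow> 'a \<Rightarrow> 'e" where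
  "coord c \<equiv> snd c"

abbreviation img_of :: "('a, 'e) chart \<Rightarrow> 'e set" where
  "img_of c \<equiv> coord c ` dom_of c"

definition param :: "('a, 'e) chart \<Rightarrow> 'e \<Rightarrow> 'a" where
  "param c = inv_into (dom_of c) (coord c)"

definition charts_at :: "('a, 'e) manifold \<Rightarrow> 'a \<Rightarrow> ('a, 'e) chart set" where
  "charts_at M x = {c \<in> atlas M. x \<in> dom_of c}"

definition chart_at :: "('a, 'e) manifold \<Rightarrow> 'a \<Rightarrow> ('a, 'e) chart" where
  "chart_at M x = (SOME c. c \<in> charts_at M x)"

locale smooth_manifold =
  fixes M :: "('a, 'e::euclidean_space) manifold"
  assumes hausdorff: "Hausdorff_space (mtop M)"
    and second_countable: "second_countable (mtop M)"
    and chart_domain_open: "c \<in> atlas M \<Longrightarrow> openin (mtop M) (dom_of c)"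
    and chart_image_open: "c \<in> atlas M \<Longrightarrow> open (img_of c)"
    and chart_homeo: "c \<in> atlas M \<Longrightarrow>
      homeomorphic_map (subtopology (mtop M) (dom_of c)) (top_of_set (img_of c)) (coord c)"
    and charts_cover: "(\<Union>c\<in>atlas M. dom_of c) = points M"
    and charts_compatible: "\<lbrakk>c \<in> atlas M; d \<in> atlas M\<rbrakk> \<Longrightarrow>
      smooth_on (coord c ` (dom_of c \<inter> dom_of d)) (coord d \<circ> param c)"

definition smooth_fun :: "('a, 'e::euclidean_space) manifold \<Rightarrow> ('a \<Rightarrow> real) \<Rightarrow> bool" where
  "smooth_fun M f \<longleftrightarrow> (\<forall>c\<in>atlas M. smooth_on (img_of c) (f \<circ> param c))"

definition smooth_map ::
  "('a, 'e::euclidean_space) manifold \<Rightarrow> ('b, 'f::euclidean_space) manifold \<Rightarrow> ('a \<Rightarrow> 'b) \<Rightarrow> bool"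
where
  "smooth_map M N F \<longleftrightarrow> continuous_map (mtop M) (mtop N) F \<and>
     (\<forall>c\<in>atlas M. \<forall>d\<in>atlas N.
        smooth_on (coord c ` {x \<in> dom_of c. F x \<in> dom_of d}) (coord d \<circ> F \<circ> param c))"

text \<open>
  A tangent vector at x is the family of its component vectors with respect to all the charts
  around x, related by the derivatives of the transition maps. The family is 0 at the pairs
  that are not charts around x; with this convention equality of tangent vectors is equality
  of functions, and the vector space operations are pointwise.
\<close>

type_synonym ('a, 'e) tvec = "('a, 'e) chart \<Rightarrow> 'e"

definition tangent_space ::
  "('a, 'e::euclidean_space) manifold \<Rightarrow> 'a \<Rightarrow> ('a, 'e) tvec set"
where
  "tangent_space M x = {v.
     (\<forall>c. c \<notin> charts_at M x \<longrightarrow> v c = 0) \<and>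
     (\<forall>c\<in>charts_at M x. \<forall>d\<in>charts_at M x.
        v d = frechet_derivative (coord d \<circ> param c) (at (coord c x)) (v c))}"

definition tzero :: "('a, 'e::real_vector) tvec" where
  "tzero = (\<lambda>c. 0)"

definition tadd :: "('a, 'e::real_vector) tvec \<Rightarrow> ('a, 'e) tvec \<Rightarrow> ('a, 'e) tvec" where
  "tadd u v = (\<lambda>c. u c + v c)"

definition tscale :: "real \<Rightarrow> ('a, 'e::real_vector) tvec \<Rightarrow> ('a, 'e) tvec" where
  "tscale r v = (\<lambda>c. r *\<^sub>R v c)"

text \<open>The tangent vector at x whose component vector in the chart c is a.\<close>

definition tvec_of ::
  "('a, 'e::euclidean_space) manifold \<Rightarrow> ('a, 'e) chart \<Rightarrow> 'a \<Rightarrow> 'e \<Rightarrow> ('a, 'e) tvec"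
where
  "tvec_of M c x a = (\<lambda>d. if d \<in> charts_at M x
     then frechet_derivative (coord d \<circ> param c) (at (coord c x)) a else 0)"

text \<open>
  The differential of F at x, and the derivative of a function f along a tangent vector v at x.
  By the chain rule they do not depend on the chart chosen around x.
\<close>

definition differential ::
  "('a, 'e::euclidean_space) manifold \<Rightarrow> ('b, 'f::euclidean_space) manifold \<Rightarrow> ('a \<Rightarrow> 'b) \<Rightarrow>
   'a \<Rightarrow> ('a, 'e) tvec \<Rightarrow> ('b, 'f) tvec"
where
  "differential M N F x v = (let c = chart_at M x in
     (\<lambda>d. if d \<in> charts_at N (F x)
       then frechet_derivative (coord d \<circ> F \<circ> param c) (at (coord c x)) (v c) else 0))"

definition deriv_along ::
  "('a, 'e::euclidean_space) manifold \<Rightarrow> 'a \<Rightarrow> ('a, 'e) tvec \<Rightarrow> ('a \<Rightarrow> real) \<Rightarrow> real"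
where
  "deriv_along M x v f = (let c = chart_at M x in
     frechet_derivative (f \<circ> param c) (at (coord c x)) (v c))"

text \<open>
  Linearity on tangent spaces is spelled out because the tangent spaces are carrier sets;
  the values of tensors outside the tangent spaces are irrelevant. Smoothness of a tensor
  field is smoothness of its components in the charts.
\<close>

definition linear_form_on :: "('a, 'e::real_vector) tvec set \<Rightarrow> (('a, 'e) tvec \<Rightarrow> real) \<Rightarrow> bool"
where
  "linear_form_on T w \<longleftrightarrow>
     (\<forall>u\<in>T. \<forall>v\<in>T. w (tadd u v) = w u + w v) \<and>
     (\<forall>r. \<forall>u\<in>T. w (tscale r u) = r * w u)"

definition linear_endo_on ::
  "('a, 'e::real_vector) tvec set \<Rightarrow> (('a, 'e) tvec \<Rightarrow> ('a, 'e) tvec) \<Rightarrow> bool"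
where
  "linear_endo_on T L \<longleftrightarrow>
     (\<forall>u\<in>T. L u \<in> T) \<and>
     (\<forall>u\<in>T. \<forall>v\<in>T. L (tadd u v) = tadd (L u) (L v)) \<and>
     (\<forall>r. \<forall>u\<in>T. L (tscale r u) = tscale r (L u))"

text \<open>Vector fields are taken to be 0 outside the manifold.\<close>

definition vector_field ::
  "('a, 'e::euclidean_space) manifold \<Rightarrow> ('a \<Rightarrow> ('a, 'e) tvec) \<Rightarrow> bool"
where
  "vector_field M X \<longleftrightarrow>
     (\<forall>x\<in>points M. X x \<in> tangent_space M x) \<and>
     (\<forall>x. x \<notin> points M \<longrightarrow> X x = tzero) \<and>
     (\<forall>c\<in>atlas M. smooth_on (img_of c) (\<lambda>y. X (param c y) c))"

definition one_form ::
  "('a, 'e::euclidean_space) manifold \<Rightarrow> ('a \<Rightarrow> ('a, 'e) tvec \<Rightarrow> real) \<Rightarrow> bool"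
where
  "one_form M w \<longleftrightarrow>
     (\<forall>x\<in>points M. linear_form_on (tangent_space M x) (w x)) \<and>
     (\<forall>c\<in>atlas M. \<forall>a. smooth_on (img_of c)
        (\<lambda>y. w (param c y) (tvec_of M c (param c y) a)))"

definition tensor11_field ::
  "('a, 'e::euclidean_space) manifold \<Rightarrow> ('a \<Rightarrow> ('a, 'e) tvec \<Rightarrow> ('a, 'e) tvec) \<Rightarrow> bool"
where
  "tensor11_field M L \<longleftrightarrow>
     (\<forall>x\<in>points M. linear_endo_on (tangent_space M x) (L x)) \<and>
     (\<forall>c\<in>atlas M. \<forall>a. smooth_on (img_of c)
        (\<lambda>y. L (param c y) (tvec_of M c (param c y) a) c))"

locale riemannian_manifold = smooth_manifold M
  for M :: "('a, 'e::euclidean_space) manifold" +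
  fixes g :: "'a \<Rightarrow> ('a, 'e) tvec \<Rightarrow> ('a, 'e) tvec \<Rightarrow> real"
  assumes metric_linear: "\<lbrakk>x \<in> points M; u \<in> tangent_space M x\<rbrakk> \<Longrightarrow>
      linear_form_on (tangent_space M x) (g x u)"
    and metric_sym: "\<lbrakk>x \<in> points M; u \<in> tangent_space M x; v \<in> tangent_space M x\<rbrakk> \<Longrightarrow>
      g x u v = g x v u"
    and metric_pos: "\<lbrakk>x \<in> points M; u \<in> tangent_space M x; u \<noteq> tzero\<rbrakk> \<Longrightarrow> 0 < g x u u"
    and metric_smooth: "c \<in> atlas M \<Longrightarrow> smooth_on (img_of c)
      (\<lambda>y. g (param c y) (tvec_of M c (param c y) a) (tvec_of M c (param c y) b))"

definition vf_add ::
  "('a \<Rightarrow> ('a, 'e::real_vector) tvec) \<Rightarrow> ('a \<Rightarrow> ('a, 'e) tvec) \<Rightarrow> 'a \<Rightarrow> ('a, 'e) tvec"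
where
  "vf_add X Y = (\<lambda>x. tadd (X x) (Y x))"

definition vf_scale ::
  "('a \<Rightarrow> real) \<Rightarrow> ('a \<Rightarrow> ('a, 'e::real_vector) tvec) \<Rightarrow> 'a \<Rightarrow> ('a, 'e) tvec"
where
  "vf_scale f X = (\<lambda>x. tscale (f x) (X x))"

definition vf_apply ::
  "('a, 'e::euclidean_space) manifold \<Rightarrow> ('a \<Rightarrow> ('a, 'e) tvec \<Rightarrow> ('a, 'e) tvec) \<Rightarrow>
   ('a \<Rightarrow> ('a, 'e) tvec) \<Rightarrow> 'a \<Rightarrow> ('a, 'e) tvec"
where
  "vf_apply M L X = (\<lambda>x. if x \<in> points M then L x (X x) else tzero)"

definition lie_bracket ::
  "('a, 'e::euclidean_space) manifold \<Rightarrow> ('a \<Rightarrow> ('a, 'e) tvec) \<Rightarrow> ('a \<Rightarrow> ('a, 'e) tvec) \<Rightarrow>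
   'a \<Rightarrow> ('a, 'e) tvec"
where
  "lie_bracket M X Y = (\<lambda>x c. if c \<in> charts_at M x
     then frechet_derivative (\<lambda>y. Y (param c y) c) (at (coord c x)) (X x c)
        - frechet_derivative (\<lambda>y. X (param c y) c) (at (coord c x)) (Y x c)
     else 0)"

locale levi_civita_connection = riemannian_manifold M g
  for M :: "('a, 'e::euclidean_space) manifold" and g +
  fixes nabla :: "('a \<Rightarrow> ('a, 'e) tvec) \<Rightarrow> ('a \<Rightarrow> ('a, 'e) tvec) \<Rightarrow> 'a \<Rightarrow> ('a, 'e) tvec"
  assumes nabla_field: "\<lbrakk>vector_field M X; vector_field M Y\<rbrakk> \<Longrightarrow> vector_field M (nabla X Y)"
    and nabla_add_left: "\<lbrakk>vector_field M X; vector_field M X'; vector_field M Y\<rbrakk> \<Longrightarrow>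
      nabla (vf_add X X') Y = vf_add (nabla X Y) (nabla X' Y)"
    and nabla_scale_left: "\<lbrakk>smooth_fun M f; vector_field M X; vector_field M Y\<rbrakk> \<Longrightarrow>
      nabla (vf_scale f X) Y = vf_scale f (nabla X Y)"
    and nabla_add_right: "\<lbrakk>vector_field M X; vector_field M Y; vector_field M Y'\<rbrakk> \<Longrightarrow>
      nabla X (vf_add Y Y') = vf_add (nabla X Y) (nabla X Y')"
    and nabla_leibniz: "\<lbrakk>smooth_fun M f; vector_field M X; vector_field M Y\<rbrakk> \<Longrightarrow>
      nabla X (vf_scale f Y) =
        vf_add (vf_scale (\<lambda>x. deriv_along M x (X x) f) Y) (vf_scale f (nabla X Y))"
    and torsion_free: "\<lbrakk>vector_field M X; vector_field M Y\<rbrakk> \<Longrightarrow>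
      nabla X Y = vf_add (nabla Y X) (lie_bracket M X Y)"
    and metric_compatible:
      "\<lbrakk>vector_field M X; vector_field M Y; vector_field M Z; x \<in> points M\<rbrakk> \<Longrightarrow>
      deriv_along M x (X x) (\<lambda>y. g y (Y y) (Z y)) =
        g x (nabla X Y x) (Z x) + g x (Y x) (nabla X Z x)"

text \<open>
  The covariant derivative of L along X, evaluated at Y, is
  \<open>nabla X (L Y) - L (nabla X Y)\<close>.
\<close>

definition parallel11 ::
  "('a, 'e::euclidean_space) manifold \<Rightarrow>
   (('a \<Rightarrow> ('a, 'e) tvec) \<Rightarrow> ('a \<Rightarrow> ('a, 'e) tvec) \<Rightarrow> 'a \<Rightarrow> ('a, 'e) tvec) \<Rightarrow>
   ('a \<Rightarrow> ('a, 'e) tvec \<Rightarrow> ('a, 'e) tvec) \<Rightarrow> bool"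
where
  "parallel11 M nabla L \<longleftrightarrow> (\<forall>X Y. vector_field M X \<longrightarrow> vector_field M Y \<longrightarrow>
     nabla X (vf_apply M L Y) = vf_apply M L (nabla X Y))"

locale metallic_riemannian_manifold = riemannian_manifold M g
  for M :: "('a, 'e::euclidean_space) manifold" and g +
  fixes J :: "'a \<Rightarrow> ('a, 'e) tvec \<Rightarrow> ('a, 'e) tvec"
    and p q :: nat
  assumes p_pos: "0 < p" and q_pos: "0 < q"
    and J_tensor: "tensor11_field M J"
    and J_metallic: "\<lbrakk>x \<in> points M; v \<in> tangent_space M x\<rbrakk> \<Longrightarrow>
      J x (J x v) = tadd (tscale (real p) (J x v)) (tscale (real q) v)"
    and J_self_adjoint: "\<lbrakk>x \<in> points M; u \<in> tangent_space M x; v \<in> tangent_space M x\<rbrakk> \<Longrightarrow>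
      g x (J x u) v = g x u (J x v)"
    and J_parallel: "\<exists>nabla. levi_civita_connection M g nabla \<and> parallel11 M nabla J"

locale almost_contact_metric_manifold = riemannian_manifold M g
  for M :: "('a, 'e::euclidean_space) manifold" and g +
  fixes \<phi> :: "'a \<Rightarrow> ('a, 'e) tvec \<Rightarrow> ('a, 'e) tvec"
    and \<xi> :: "'a \<Rightarrow> ('a, 'e) tvec"
    and \<eta> :: "'a \<Rightarrow> ('a, 'e) tvec \<Rightarrow> real"
  assumes dimension_odd: "\<exists>n. DIM('e) = 2 * n + 1"
    and phi_tensor: "tensor11_field M \<phi>"
    and xi_field: "vector_field M \<xi>"
    and eta_form: "one_form M \<eta>"
    and phi_phi: "\<lbrakk>x \<in> points M; v \<in> tangent_space M x\<rbrakk> \<Longrightarrow>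
      \<phi> x (\<phi> x v) = tadd (tscale (-1) v) (tscale (\<eta> x v) (\<xi> x))"
    and phi_xi: "x \<in> points M \<Longrightarrow> \<phi> x (\<xi> x) = tzero"
    and eta_phi: "\<lbrakk>x \<in> points M; v \<in> tangent_space M x\<rbrakk> \<Longrightarrow> \<eta> x (\<phi> x v) = 0"
    and eta_xi: "x \<in> points M \<Longrightarrow> \<eta> x (\<xi> x) = 1"
    and metric_phi: "\<lbrakk>x \<in> points M; u \<in> tangent_space M x; v \<in> tangent_space M x\<rbrakk> \<Longrightarrow>
      g x (\<phi> x u) (\<phi> x v) = g x u v - \<eta> x u * \<eta> x v"
    and eta_metric: "\<lbrakk>x \<in> points M; v \<in> tangent_space M x\<rbrakk> \<Longrightarrow> \<eta> x v = g x v (\<xi> x)"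

end

theory Submission
  imports Defs
begin

text \<open>
  If \<open>w = F\<^sub>* v\<close>, then \<open>\<phi>\<^sup>2 w = p \<phi> w + q w\<close>. Comparing with \<open>\<phi>\<^sup>2 w = - w + \<eta>(w) \<xi>\<close> and
  applying \<open>\<eta>\<close> gives \<open>\<eta>(w) = 0\<close>, so \<open>w\<close> would be an eigenvector of \<open>\<phi>\<close> for the real eigenvalue
  \<open>- (q + 1) / p\<close>, while \<open>\<phi>\<^sup>2 w = - w\<close>; hence \<open>w = 0\<close>. A map with vanishing differential is
  locally constant, hence constant on a connected manifold.
\<close>

section \<open>Access rules for smoothness, tangent vectors and linearity\<close>

lemma smooth_on_differentiable:
  assumes "smooth_on S f" "x \<in> S"
  shows "f differentiable (at x)"
proof -
  have "Ck_on (Suc 0) S f"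
    using assms(1) unfolding smooth_on_def by blast
  then show ?thesis using assms(2) by simp
qed

lemma tangent_spaceI:
  assumes "\<And>c. c \<notin> charts_at M x \<Longrightarrow> v c = 0"
    and "\<And>c d. c \<in> charts_at M x \<Longrightarrow> d \<in> charts_at M x \<Longrightarrow>
      v d = frechet_derivative (coord d \<circ> param c) (at (coord c x)) (v c)"
  shows "v \<in> tangent_space M x"
  using assms unfolding tangent_space_def by blast

lemma tangent_spaceD:
  assumes "v \<in> tangent_space M x"
  shows "c \<notin> charts_at M x \<Longrightarrow> v c = 0"
    and "c \<in> charts_at M x \<Longrightarrow> d \<in> charts_at M x \<Longrightarrow>
      v d = frechet_derivative (coord d \<circ> param c) (at (coord c x)) (v c)"
  using assms unfolding tangent_space_def by blast+

lemma linear_endo_onD: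
  assumes "linear_endo_on T L"
  shows "u \<in> T \<Longrightarrow> L u \<in> T"
    and "u \<in> T \<Longrightarrow> L (tscale r u) = tscale r (L u)"
  using assms unfolding linear_endo_on_def by auto

lemma linear_form_onD:
  assumes "linear_form_on T w"
  shows "u \<in> T \<Longrightarrow> v \<in> T \<Longrightarrow> w (tadd u v) = w u + w v"
    and "u \<in> T \<Longrightarrow> w (tscale r u) = r * w u"
  using assms unfolding linear_form_on_def by auto

section \<open>Charts, change of chart and tangent spaces of one manifold\<close>

context smooth_manifold
begin

lemma inj_on_coord: "c \<in> atlas M \<Longrightarrow> inj_on (coord c) (dom_of c)"
  using chart_homeo[of c] chart_domain_open[of c] openin_subset[of "mtop M" "dom_of c"]
  by (auto dest!: homeomorphic_imp_injective_map simp: Int_absorb1)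

lemma param_coord: "c \<in> atlas M \<Longrightarrow> x \<in> dom_of c \<Longrightarrow> param c (coord c x) = x"
  unfolding param_def by (rule inv_into_f_f[OF inj_on_coord])

lemma coord_param: "y \<in> img_of c \<Longrightarrow> coord c (param c y) = y"
  unfolding param_def by (rule f_inv_into_f)

lemma param_in_dom: "y \<in> img_of c \<Longrightarrow> param c y \<in> dom_of c"
  unfolding param_def by (rule inv_into_into)

text \<open>A homeomorphism gives relative openness only; since the image of the chart is itself
  open, this becomes openness in the model space, so derivatives at points of the image are
  determined there.\<close>

lemma open_coord_image:
  assumes "c \<in> atlas M" "openin (mtop M) U" "U \<subseteq> dom_of c"
  shows "open (coord c ` U)"
proof -
  have "openin (subtopology (mtop M) (dom_of c)) U"
    using assms by (simp add: openin_open_subtopology chart_domain_open)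
  then have "openin (top_of_set (img_of c)) (coord c ` U)"
    using chart_homeo[OF assms(1)] homeomorphic_imp_open_map open_map_def by blast
  then show ?thesis
    using chart_image_open[OF assms(1)] openin_open_eq by blast
qed

text \<open>On \<open>V\<close> the inverse \<open>param c\<close> turns images into preimages under
  \<open>coord c\<close>, so continuity of \<open>coord c\<close> suffices.\<close>

lemma open_param_image:
  assumes "c \<in> atlas M" "open V" "V \<subseteq> img_of c"
  shows "openin (mtop M) (param c ` V)"
proof -
  have "continuous_map (subtopology (mtop M) (dom_of c)) (top_of_set (img_of c)) (coord c)"
    using chart_homeo[OF assms(1)] homeomorphic_imp_continuous_map by blast
  moreover have "openin (top_of_set (img_of c)) V"
    using assms(2,3) by (simp add: open_subset)
  ultimately have "openin (subtopology (mtop M) (dom_of c))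
      {x \<in> topspace (subtopology (mtop M) (dom_of c)). coord c x \<in> V}"
    using openin_continuous_map_preimage by blast
  moreover have "{x \<in> topspace (subtopology (mtop M) (dom_of c)). coord c x \<in> V} = param c ` V"
  proof -
    have "dom_of c \<subseteq> points M"
      using chart_domain_open[OF assms(1)] by (rule openin_subset)
    moreover have "{x \<in> dom_of c. coord c x \<in> V} = param c ` V"
    proof
      show "{x \<in> dom_of c. coord c x \<in> V} \<subseteq> param c ` V"
        using param_coord[OF assms(1)] by (auto simp: image_iff intro: sym)
      show "param c ` V \<subseteq> {x \<in> dom_of c. coord c x \<in> V}"
        using subsetD[OF assms(3)] by (simp add: image_subset_iff coord_param param_in_dom)
    qed
    ultimately show ?thesis
      by (simp add: Int_absorb1)
  qed
  ultimately show ?thesis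
    using openin_trans_full[OF _ chart_domain_open[OF assms(1)]] by metis
qed

lemma charts_at_nonempty: "x \<in> points M \<Longrightarrow> charts_at M x \<noteq> {}"
  using charts_cover unfolding charts_at_def by blast

lemma chart_at_in: "x \<in> points M \<Longrightarrow> chart_at M x \<in> charts_at M x"
  using charts_at_nonempty unfolding chart_at_def by (simp add: some_in_eq)

lemma transition_differentiable:
  assumes "c \<in> charts_at M x" "d \<in> charts_at M x"
  shows "(coord d \<circ> param c) differentiable (at (coord c x))"
  using assms charts_compatible[of c d] unfolding charts_at_def
  by (auto intro: smooth_on_differentiable)

lemma transition_linear:
  assumes "c \<in> charts_at M x" "d \<in> charts_at M x"
  shows "linear (frechet_derivative (coord d \<circ> param c) (at (coord c x)))"
  by (rule linear_frechet_derivative[OF transition_differentiable[OF assms]])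

lemma tangent_space_tscale:
  assumes "u \<in> tangent_space M x"
  shows "tscale r u \<in> tangent_space M x"
proof (rule tangent_spaceI)
  show "c \<notin> charts_at M x \<Longrightarrow> tscale r u c = 0" for c
    by (simp add: tscale_def tangent_spaceD(1)[OF assms])
next
  fix c d assume c: "c \<in> charts_at M x" and d: "d \<in> charts_at M x"
  show "tscale r u d = frechet_derivative (coord d \<circ> param c) (at (coord c x)) (tscale r u c)"
    unfolding tscale_def linear_cmul[OF transition_linear[OF c d]]
    using tangent_spaceD(2)[OF assms c d] by simp
qed

text \<open>This is the chain rule for
  \<open>(f \<circ> param d) \<circ> (coord d \<circ> param c)\<close>. That composite is known to
  agree with \<open>f \<circ> param c\<close> only over the overlap of the two charts; the overlap
  has an open coordinate image, and this is enough to transfer the derivative.\<close>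

lemma frechet_derivative_change_chart:
  fixes f :: "'a \<Rightarrow> 'c::real_normed_vector"
  assumes c: "c \<in> charts_at M x" and d: "d \<in> charts_at M x"
    and f: "(f \<circ> param d) differentiable (at (coord d x))"
  shows "((f \<circ> param c) has_derivative
      (frechet_derivative (f \<circ> param d) (at (coord d x)) \<circ>
       frechet_derivative (coord d \<circ> param c) (at (coord c x)))) (at (coord c x))"
proof -
  have in_atlas: "c \<in> atlas M" "d \<in> atlas M" and x: "x \<in> dom_of c \<inter> dom_of d"
    using c d unfolding charts_at_def by auto
  have point: "(coord d \<circ> param c) (coord c x) = coord d x"
    using param_coord in_atlas x by simp
  have comp: "((f \<circ> param d) \<circ> (coord d \<circ> param c) has_derivative
      (frechet_derivative (f \<circ> param d) (at (coord d x)) \<circ>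
       frechet_derivative (coord d \<circ> param c) (at (coord c x)))) (at (coord c x))"
    using f transition_differentiable[OF c d] point
    by (intro diff_chain_at) (simp_all add: frechet_derivative_works)
  have V: "open (coord c ` (dom_of c \<inter> dom_of d))"
    using in_atlas by (intro open_coord_image openin_Int chart_domain_open) auto
  show ?thesis
  proof (rule has_derivative_transform_within_open[OF comp V])
    show "coord c x \<in> coord c ` (dom_of c \<inter> dom_of d)"
      using x by blast
    fix y assume "y \<in> coord c ` (dom_of c \<inter> dom_of d)"
    then show "((f \<circ> param d) \<circ> (coord d \<circ> param c)) y = (f \<circ> param c) y"
      using param_coord[OF in_atlas(1)] param_coord[OF in_atlas(2)] by auto
  qed
qed

text \<open>The compatibility of components is the cocycle identity for transition derivatives,
  which is the change of chart rule with \<open>f\<close> taken to be the coordinate map of a third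
  chart.\<close>

lemma tvec_of_in_tangent_space:
  assumes c: "c \<in> charts_at M x"
  shows "tvec_of M c x a \<in> tangent_space M x"
proof -
  have "frechet_derivative (coord e \<circ> param c) (at (coord c x)) a =
      frechet_derivative (coord e \<circ> param d) (at (coord d x))
        (frechet_derivative (coord d \<circ> param c) (at (coord c x)) a)"
    if d: "d \<in> charts_at M x" and e: "e \<in> charts_at M x" for d e
    using frechet_derivative_at[OF frechet_derivative_change_chart
        [OF c d transition_differentiable[OF d e]]]
    by (metis comp_apply)
  note chain = this
  show ?thesis
  proof (rule tangent_spaceI)
    fix d assume "d \<notin> charts_at M x"
    then show "tvec_of M c x a d = 0"
      by (simp add: tvec_of_def)
  next
    fix d e assume d: "d \<in> charts_at M x" and e: "e \<in> charts_at M x"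
    show "tvec_of M c x a e = frechet_derivative (coord e \<circ> param d) (at (coord d x))
        (tvec_of M c x a d)"
      using chain[OF d e] d e unfolding tvec_of_def by (simp only: if_True)
  qed
qed

text \<open>Every vector of the model space is thus the component of some tangent vector, so a
  statement about all tangent vectors at a point becomes one about all directions in a
  chart.\<close>

lemma tvec_of_self:
  assumes c: "c \<in> charts_at M x"
  shows "tvec_of M c x a c = a"
proof -
  have c': "c \<in> atlas M" "x \<in> dom_of c"
    using c unfolding charts_at_def by auto
  have "(coord c \<circ> param c has_derivative (\<lambda>h. h)) (at (coord c x))"
    using c' coord_param[of _ c]
    by (intro has_derivative_transform_within_open[OF has_derivative_ident chart_image_open]) auto
  then have "frechet_derivative (coord c \<circ> param c) (at (coord c x)) = (\<lambda>h. h)"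
    by (simp add: frechet_derivative_at[symmetric])
  then show ?thesis
    using c unfolding tvec_of_def by simp
qed

end

section \<open>The differential of a smooth map\<close>

locale smooth_map_between = dom: smooth_manifold M + cod: smooth_manifold N
  for M :: "('a, 'e::euclidean_space) manifold" and N :: "('b, 'f::euclidean_space) manifold" +
  fixes F :: "'a \<Rightarrow> 'b"
  assumes smooth_map: "smooth_map M N F"
begin

lemma continuous_F: "continuous_map (mtop M) (mtop N) F"
  using smooth_map unfolding smooth_map_def by blast

lemma F_in_points: "x \<in> points M \<Longrightarrow> F x \<in> points N"
  using continuous_F by (auto simp: continuous_map_def)

lemma local_rep_differentiable:
  assumes "c \<in> charts_at M x" "d \<in> charts_at N (F x)"
  shows "(coord d \<circ> F \<circ> param c) differentiable (at (coord c x))"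
  using assms smooth_map unfolding charts_at_def smooth_map_def
  by (auto intro!: smooth_on_differentiable)

text \<open>Only the component in the chosen chart \<open>chart_at M x\<close> enters the
  differential, so additivity holds for arbitrary families \<open>u\<close> and \<open>v\<close>,
  with no tangency to check.\<close>

lemma differential_tadd:
  assumes "x \<in> points M"
  shows "differential M N F x (tadd u v) = tadd (differential M N F x u) (differential M N F x v)"
  using linear_add[OF linear_frechet_derivative
      [OF local_rep_differentiable[OF dom.chart_at_in[OF assms]]]]
  unfolding differential_def tadd_def Let_def by auto

lemma differential_tscale:
  assumes "x \<in> points M"
  shows "differential M N F x (tscale r u) = tscale r (differential M N F x u)"
  using linear_cmul[OF linear_frechet_derivative
      [OF local_rep_differentiable[OF dom.chart_at_in[OF assms]]]]
  unfolding differential_def tscale_def Let_def by auto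

text \<open>The source chart is fixed by the definition, so only the target charts vary: the local
  representations of \<open>F\<close> in \<open>d\<close> and \<open>e\<close> differ by a
  transition map, and the chain rule relates their derivatives.\<close>

lemma differential_in_tangent_space:
  assumes x: "x \<in> points M"
  shows "differential M N F x v \<in> tangent_space N (F x)"
proof -
  define c where "c = chart_at M x"
  have c: "c \<in> charts_at M x"
    unfolding c_def by (rule dom.chart_at_in[OF x])
  have c': "c \<in> atlas M" "x \<in> dom_of c"
    using c unfolding charts_at_def by auto
  have "frechet_derivative (coord e \<circ> F \<circ> param c) (at (coord c x)) a =
      frechet_derivative (coord e \<circ> param d) (at (coord d (F x)))
        (frechet_derivative (coord d \<circ> F \<circ> param c) (at (coord c x)) a)"
    if d: "d \<in> charts_at N (F x)" and e: "e \<in> charts_at N (F x)" for d e a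
  proof -
    have d': "d \<in> atlas N" "F x \<in> dom_of d"
      using d unfolding charts_at_def by auto
    have point: "(coord d \<circ> F \<circ> param c) (coord c x) = coord d (F x)"
      using dom.param_coord c' by simp
    have comp: "((coord e \<circ> param d) \<circ> (coord d \<circ> F \<circ> param c) has_derivative
        (frechet_derivative (coord e \<circ> param d) (at (coord d (F x))) \<circ>
         frechet_derivative (coord d \<circ> F \<circ> param c) (at (coord c x)))) (at (coord c x))"
      using local_rep_differentiable[OF c d] cod.transition_differentiable[OF d e] point
      by (intro diff_chain_at) (simp_all add: frechet_derivative_works)
    \<comment> \<open>Cancelling \<open>param d\<close> against \<open>coord d\<close> requires
      \<open>F y\<close> to lie in the domain of \<open>d\<close>; continuity of \<open>F\<close>
      makes the set of such points open.\<close>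
    define U where "U = {y \<in> points M. F y \<in> dom_of d} \<inter> dom_of c"
    have "openin (mtop M) U"
      unfolding U_def
      by (intro openin_Int openin_continuous_map_preimage[OF continuous_F]
          cod.chart_domain_open dom.chart_domain_open d' c')
    then have V: "open (coord c ` U)"
      using c' by (intro dom.open_coord_image) (auto simp: U_def)
    have "(coord e \<circ> F \<circ> param c has_derivative
        (frechet_derivative (coord e \<circ> param d) (at (coord d (F x))) \<circ>
         frechet_derivative (coord d \<circ> F \<circ> param c) (at (coord c x)))) (at (coord c x))"
    proof (rule has_derivative_transform_within_open[OF comp V])
      show "coord c x \<in> coord c ` U"
        using x c' d' unfolding U_def by blast
      fix y assume "y \<in> coord c ` U"
      then show "((coord e \<circ> param d) \<circ> (coord d \<circ> F \<circ> param c)) y = (coord e \<circ> F \<circ> param c) y"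
        using dom.param_coord[OF c'(1)] cod.param_coord[OF d'(1)] unfolding U_def by auto
    qed
    from frechet_derivative_at[OF this] show ?thesis
      by (metis comp_apply)
  qed
  note chain = this
  show ?thesis
  proof (rule tangent_spaceI)
    fix d assume "d \<notin> charts_at N (F x)"
    then show "differential M N F x v d = 0"
      by (simp add: differential_def Let_def)
  next
    fix d e assume d: "d \<in> charts_at N (F x)" and e: "e \<in> charts_at N (F x)"
    show "differential M N F x v e = frechet_derivative (coord e \<circ> param d) (at (coord d (F x)))
        (differential M N F x v d)"
      using chain[OF d e, of "v c"] d e
      unfolding differential_def Let_def c_def[symmetric] by (simp only: if_True)
  qed
qed

section \<open>From a vanishing differential to a constant map\<close>

text \<open>The differential is read in the chart chosen at \<open>x\<close>, which may change from
  point to point. Testing it on the vectors \<open>tvec_of\<close> kills the derivative in that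
  chart, and the change of chart rule carries this to any chart \<open>c\<close>, so that one chart
  can serve a whole neighbourhood.\<close>

lemma local_rep_derivative_zero:
  assumes x: "x \<in> points M"
    and zero: "\<And>v. v \<in> tangent_space M x \<Longrightarrow> differential M N F x v = tzero"
    and c: "c \<in> charts_at M x" and d: "d \<in> charts_at N (F x)"
  shows "((coord d \<circ> F \<circ> param c) has_derivative (\<lambda>h. 0)) (at (coord c x))"
proof -
  define c' where "c' = chart_at M x"
  have c': "c' \<in> charts_at M x"
    unfolding c'_def by (rule dom.chart_at_in[OF x])
  have "frechet_derivative (coord d \<circ> F \<circ> param c') (at (coord c' x)) a = 0" for a
    using fun_cong[OF zero[OF dom.tvec_of_in_tangent_space[OF c', of a]], of d]
      dom.tvec_of_self[OF c', of a] d
    unfolding differential_def Let_def c'_def[symmetric] tzero_def by simp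
  then show ?thesis
    using dom.frechet_derivative_change_chart[OF c c' local_rep_differentiable[OF c' d]]
    by (simp add: comp_def)
qed

lemma locally_constant:
  assumes zero: "\<And>x v. x \<in> points M \<Longrightarrow> v \<in> tangent_space M x \<Longrightarrow> differential M N F x v = tzero"
    and x: "x \<in> points M"
  shows "\<exists>U. openin (mtop M) U \<and> x \<in> U \<and> (\<forall>y\<in>U. F y = F x)"
proof -
  obtain c d where c: "c \<in> charts_at M x" and d: "d \<in> charts_at N (F x)"
    using dom.charts_at_nonempty[OF x] cod.charts_at_nonempty[OF F_in_points[OF x]] by blast
  then have c': "c \<in> atlas M" "x \<in> dom_of c" and d': "d \<in> atlas N" "F x \<in> dom_of d"
    unfolding charts_at_def by auto
  define U where "U = {y \<in> points M. F y \<in> dom_of d} \<inter> dom_of c"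
  have "openin (mtop M) U"
    unfolding U_def
    by (intro openin_Int openin_continuous_map_preimage[OF continuous_F]
        cod.chart_domain_open dom.chart_domain_open d' c')
  then have V: "open (coord c ` U)"
    using c' by (intro dom.open_coord_image) (auto simp: U_def)
  have "x \<in> U"
    using x c' d' unfolding U_def by blast
  \<comment> \<open>A ball inside the image of \<open>U\<close> keeps \<open>F\<close> within the
    domain of \<open>d\<close>, and its convexity makes a zero derivative force a constant.\<close>
  then obtain r where r: "r > 0" "ball (coord c x) r \<subseteq> coord c ` U"
    using V by (meson imageI open_contains_ball)
  have img: "ball (coord c x) r \<subseteq> img_of c"
    using r(2) unfolding U_def by blast
  let ?h = "coord d \<circ> F \<circ> param c"
  have in_U: "param c y \<in> U" if y: "y \<in> ball (coord c x) r" for y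
  proof -
    obtain z where "z \<in> U" "y = coord c z"
      using y r(2) by blast
    then show ?thesis
      using dom.param_coord[OF c'(1), of z] unfolding U_def by simp
  qed
  have deriv: "(?h has_derivative (\<lambda>h. 0)) (at y within ball (coord c x) r)"
    if y: "y \<in> ball (coord c x) r" for y
  proof -
    have in_dom: "param c y \<in> points M" "c \<in> charts_at M (param c y)" "d \<in> charts_at N (F (param c y))"
      using in_U[OF y] c' d' unfolding U_def charts_at_def by auto
    then have "(?h has_derivative (\<lambda>h. 0)) (at (coord c (param c y)))"
      using local_rep_derivative_zero[OF in_dom(1) zero[OF in_dom(1)]] by blast
    then show ?thesis
      using dom.coord_param[OF subsetD[OF img y]] by (simp add: has_derivative_at_withinI)
  qed
  have const: "F (param c y) = F x" if y: "y \<in> ball (coord c x) r" for y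
  proof -
    have "\<exists>k. \<forall>z\<in>ball (coord c x) r. ?h z = k"
      by (rule has_derivative_zero_constant[OF convex_ball deriv])
    then have "?h y = ?h (coord c x)"
      using y r(1) by (metis centre_in_ball)
    then have "coord d (F (param c y)) = coord d (F x)"
      using dom.param_coord c' by simp
    \<comment> \<open>Equal coordinates give equal points only inside the domain of
      \<open>d\<close>, where \<open>coord d\<close> is injective.\<close>
    moreover have "F (param c y) \<in> dom_of d"
      using in_U[OF y] unfolding U_def by blast
    ultimately show ?thesis
      using cod.inj_on_coord[OF d'(1)] d'(2) by (auto dest: inj_onD)
  qed
  have "openin (mtop M) (param c ` ball (coord c x) r)"
    using c' img by (intro dom.open_param_image) auto
  moreover have "x \<in> param c ` ball (coord c x) r"
    using r(1) dom.param_coord[OF c'] by (metis centre_in_ball imageI)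
  ultimately show ?thesis
    using const by blast
qed

lemma constant_if_differential_zero:
  assumes conn: "connected_space (mtop M)"
    and zero: "\<And>x v. x \<in> points M \<Longrightarrow> v \<in> tangent_space M x \<Longrightarrow> differential M N F x v = tzero"
  shows "F constant_on points M"
proof (cases "points M = {}")
  case True
  then show ?thesis by (simp add: constant_on_def)
next
  case False
  then obtain x where x: "x \<in> points M" by blast
  \<comment> \<open>An arbitrary predicate on values treats a level set and its complement at once:
    membership depends only on the value of \<open>F\<close>, which is constant near each
    point.\<close>
  have level_open: "openin (mtop M) {y \<in> points M. P (F y)}" for P
  proof (subst openin_subopen, intro ballI)
    fix y assume y: "y \<in> {y \<in> points M. P (F y)}"
    have "\<exists>U. openin (mtop M) U \<and> y \<in> U \<and> (\<forall>z\<in>U. F z = F y)"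
    proof (rule locally_constant)
      show "y \<in> points M"
        using y by simp
    qed (rule zero)
    then obtain U where U: "openin (mtop M) U" "y \<in> U" "\<forall>z\<in>U. F z = F y"
      by blast
    have "U \<subseteq> {y \<in> points M. P (F y)}"
    proof
      fix z assume z: "z \<in> U"
      have "z \<in> points M"
        using z openin_subset[OF U(1)] by blast
      moreover have "F z = F y"
        using z U(3) by blast
      ultimately show "z \<in> {y \<in> points M. P (F y)}"
        using y by simp
    qed
    then show "\<exists>T. openin (mtop M) T \<and> y \<in> T \<and> T \<subseteq> {y \<in> points M. P (F y)}"
      using U(1,2) by blast
  qed
  define A where "A = {y \<in> points M. F y = F x}"
  define B where "B = {y \<in> points M. F y \<noteq> F x}"
  have "openin (mtop M) A" "openin (mtop M) B"
    unfolding A_def B_def by (rule level_open)+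
  moreover have "points M \<subseteq> A \<union> B" "A \<inter> B = {}" "A \<noteq> {}"
    using x unfolding A_def B_def by auto
  ultimately have "B = {}"
    using conn unfolding connected_space_def by blast
  then have "\<forall>y\<in>points M. F y = F x"
    unfolding B_def by blast
  then show ?thesis
    unfolding constant_on_def by blast
qed

end

section \<open>Linear algebra in a tangent space of an almost contact metric manifold\<close>

context almost_contact_metric_manifold
begin

lemma metallic_vector_zero:
  assumes x: "x \<in> points M" and w: "w \<in> tangent_space M x"
    and p: "0 < a" and q: "0 < b"
    and eq: "\<phi> x (\<phi> x w) = tadd (tscale a (\<phi> x w)) (tscale b w)"
  shows "w = tzero"
proof -
  have endo: "linear_endo_on (tangent_space M x) (\<phi> x)"
    using phi_tensor x unfolding tensor11_field_def by blast
  have form: "linear_form_on (tangent_space M x) (\<eta> x)"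
    using eta_form x unfolding one_form_def by blast
  have phi_w: "\<phi> x w \<in> tangent_space M x"
    using linear_endo_onD(1)[OF endo w] .
  \<comment> \<open>Both \<open>\<eta>\<close> terms with an outer \<open>\<phi>\<close> vanish,
    which leaves \<open>b * \<eta> x w = 0\<close> with \<open>b\<close> positive.\<close>
  have "\<eta> x (\<phi> x (\<phi> x w)) = a * \<eta> x (\<phi> x w) + b * \<eta> x w"
    using w phi_w unfolding eq
    by (simp add: linear_form_onD[OF form] tangent_space_tscale)
  then have "\<eta> x w = 0"
    using eta_phi[OF x] w phi_w q by simp
  then have square: "\<phi> x (\<phi> x w) = tscale (-1) w"
    using phi_phi[OF x w] by (simp add: tadd_def tscale_def)
  have eigen: "\<phi> x w = tscale (- (b + 1) / a) w"
  proof
    fix c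
    have "- w c = a *\<^sub>R \<phi> x w c + b *\<^sub>R w c"
      using fun_cong[OF square, of c] unfolding eq by (simp add: tadd_def tscale_def)
    then have "a *\<^sub>R \<phi> x w c = - (b + 1) *\<^sub>R w c"
      by (simp add: algebra_simps eq_neg_iff_add_eq_0)
    then have "(1 / a) *\<^sub>R a *\<^sub>R \<phi> x w c = (1 / a) *\<^sub>R (- (b + 1)) *\<^sub>R w c"
      by simp
    then show "\<phi> x w c = tscale (- (b + 1) / a) w c"
      using p by (simp add: tscale_def)
  qed
  define k where "k = - (b + 1) / a"
  \<comment> \<open>The vector \<open>\<phi> x (tscale k w)\<close> is evaluated twice: by linearity
    it is \<open>w\<close> scaled by the square of \<open>k\<close>, and since
    \<open>tscale k w\<close> is \<open>\<phi> x w\<close> it is also \<open>w\<close> scaled by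
    -1.\<close>
  have "tscale k (tscale k w) = \<phi> x (tscale k w)"
    using linear_endo_onD(2)[OF endo w, of k] eigen by (simp only: k_def)
  also have "\<dots> = tscale (-1) w"
    using square eigen by (simp only: k_def)
  finally have "(k * k) *\<^sub>R w c = - w c" for c
    by (metis tscale_def scaleR_scaleR scaleR_minus1_left)
  then have "(k\<^sup>2 + 1) *\<^sub>R w c = 0" for c
    by (simp add: scaleR_add_left power2_eq_square)
  moreover have "0 < k\<^sup>2 + 1"
    by (simp add: add_nonneg_pos)
  ultimately have "w c = 0" for c
    by (metis scaleR_eq_0_iff less_irrefl)
  then show ?thesis
    unfolding tzero_def by blast
qed

end

text \<open>Connectedness of \<open>M\<^sub>1\<close> joins the local constants: a locally constant
  map may take different values on different components.\<close>

theorem theorem4p8: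
  fixes M\<^sub>1 :: "('a, 'e::euclidean_space) manifold"
    and g\<^sub>1 :: "'a \<Rightarrow> ('a, 'e) tvec \<Rightarrow> ('a, 'e) tvec \<Rightarrow> real"
    and J\<^sub>1 :: "'a \<Rightarrow> ('a, 'e) tvec \<Rightarrow> ('a, 'e) tvec"
    and p q :: nat
    and M :: "('b, 'f::euclidean_space) manifold"
    and \<phi> :: "'b \<Rightarrow> ('b, 'f) tvec \<Rightarrow> ('b, 'f) tvec"
    and \<xi> :: "'b \<Rightarrow> ('b, 'f) tvec"
    and \<eta> :: "'b \<Rightarrow> ('b, 'f) tvec \<Rightarrow> real"
    and g :: "'b \<Rightarrow> ('b, 'f) tvec \<Rightarrow> ('b, 'f) tvec \<Rightarrow> real"
    and F :: "'a \<Rightarrow> 'b"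
  assumes "metallic_riemannian_manifold M\<^sub>1 g\<^sub>1 J\<^sub>1 p q"
    and "connected_space (mtop M\<^sub>1)"
    and "almost_contact_metric_manifold M g \<phi> \<xi> \<eta>"
    and "smooth_map M\<^sub>1 M F"
    and "\<And>x v. \<lbrakk>x \<in> points M\<^sub>1; v \<in> tangent_space M\<^sub>1 x\<rbrakk> \<Longrightarrow>
      differential M\<^sub>1 M F x (J\<^sub>1 x v) = \<phi> (F x) (differential M\<^sub>1 M F x v)"
  shows "F constant_on points M\<^sub>1"
proof -
  interpret M1: metallic_riemannian_manifold M\<^sub>1 g\<^sub>1 J\<^sub>1 p q by fact
  interpret M: almost_contact_metric_manifold M g \<phi> \<xi> \<eta> by fact
  interpret F: smooth_map_between M\<^sub>1 M F
    by unfold_locales fact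
  show ?thesis
  proof (rule F.constant_if_differential_zero[OF assms(2)])
    fix x v assume x: "x \<in> points M\<^sub>1" and v: "v \<in> tangent_space M\<^sub>1 x"
    let ?D = "differential M\<^sub>1 M F x"
    \<comment> \<open>The commutation hypothesis concerns tangent vectors, so moving the
      differential past \<open>J\<^sub>1\<close> a second time requires \<open>J\<^sub>1 x v\<close>
      to be tangent.\<close>
    have Jv: "J\<^sub>1 x v \<in> tangent_space M\<^sub>1 x"
      using M1.J_tensor x v unfolding tensor11_field_def by (blast dest: linear_endo_onD(1))
    have "\<phi> (F x) (\<phi> (F x) (?D v)) = ?D (J\<^sub>1 x (J\<^sub>1 x v))"
      by (simp only: assms(5)[OF x v] assms(5)[OF x Jv])
    \<comment> \<open>Linearity of the differential transports the metallic equation of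
      \<open>J\<^sub>1\<close> to \<open>\<phi>\<close> on the image vector, with the same positive
      coefficients.\<close>
    also have "\<dots> = tadd (tscale (real p) (\<phi> (F x) (?D v))) (tscale (real q) (?D v))"
      by (simp only: M1.J_metallic[OF x v] F.differential_tadd[OF x] F.differential_tscale[OF x]
          assms(5)[OF x v])
    finally show "?D v = tzero"
      using M.metallic_vector_zero[OF F.F_in_points[OF x] F.differential_in_tangent_space[OF x],
          of "real p" "real q" v] M1.p_pos M1.q_pos by simp
  qed
qed

end
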